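(* Let $n\ge 2$. Then $a_0$ divides $DD_{n,1}$ in $\mathbb{Z}[a_0,a_2,a_3,\ldots,a_n]$.
   Context: Let $a_0,\ldots,a_n$ be independent indeterminates, $f(x)=\sum_{i=0}^n a_ix^i$, and let $D_n\in\mathbb{Z}[a_0,\ldots,a_n]$ be its discriminant (normalized so that for $f=a_n\prod_{i=1}^n(x-r_i)$, $D_n=a_n^{2n-2}\prod_{i<j}(r_i-r_j)^2$). The double discriminant is $DD_{n,k}=\operatorname{disc}_{a_k}(D_n)\in\mathbb{Z}[a_i: i\neq k]$, the discriminant of $D_n$ regarded as a polynomial in the single variable $a_k$, with the normalization $\operatorname{disc} g=c^{2d-2}\prod_{i<j}(\rho_i-\rho_j)^2$ for $g$ of degree $d$, leading coefficient $c$, roots $\rho_i$. *)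

theory Defs
  imports
    "HOL-Library.Poly_Mapping"
    "HOL-Computational_Algebra.Polynomial_Factorial"
    "HOL-Algebra.Algebraic_Closure_Type"
begin

text \<open>
  The discriminant of a polynomial over an integral domain, by the product formula over its roots
  in an algebraic closure of the fraction field. The roots are listed with multiplicity; the value
  does not depend on the order of the list, and since the discriminant is an integer polynomial in
  the coefficients it lies in the domain itself. The definition is meant for positive degree: the
  subtraction in the exponent truncates in degree 0.
\<close>

definition to_closure :: "'a::idom \<Rightarrow> 'a fract alg_closure" where
  "to_closure c = to_ac (to_fract c)"

definition is_root_list :: "'a::idom poly \<Rightarrow> 'a fract alg_closure list \<Rightarrow> bool" where
  "is_root_list p rs \<longleftrightarrow>
     map_poly to_closure p =
       Polynomial.smult (to_closure (Polynomial.lead_coeff p)) (\<Prod>r\<leftarrow>rs. [:- r, 1:])"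

definition disc :: "'a::idom poly \<Rightarrow> 'a" where
  "disc p = (THE d. \<forall>rs. is_root_list p rs \<longrightarrow>
     to_closure d =
       to_closure (Polynomial.lead_coeff p) ^ (2 * Polynomial.degree p - 2) *
       (\<Prod>(i, j)\<in>{(i, j). i < j \<and> j < length rs}. (rs ! i - rs ! j)\<^sup>2))"

text \<open>
  Polynomials with integer coefficients in the countably many indeterminates
  \<open>a\<^sub>0, a\<^sub>1, \<dots>\<close>, as finitely supported functions from exponent vectors to coefficients.
  The subring of polynomials in the indeterminates with index in \<open>V\<close> is \<open>polys_in V\<close>.
\<close>

type_synonym int_mpoly = "(nat \<Rightarrow>\<^sub>0 nat) \<Rightarrow>\<^sub>0 int"

definition indet :: "nat \<Rightarrow> int_mpoly" where
  "indet i = Poly_Mapping.single (Poly_Mapping.single i 1) 1"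

definition polys_in :: "nat set \<Rightarrow> int_mpoly set" where
  "polys_in V = {P. \<forall>m\<in>Poly_Mapping.keys P. Poly_Mapping.keys m \<subseteq> V}"

text \<open>
  \<open>P\<close> regarded as a univariate polynomial in \<open>a\<^sub>k\<close>: the exponent of \<open>a\<^sub>k\<close> in each monomial
  becomes the degree, and the remaining monomial goes into the coefficient.
\<close>

definition poly_in_var :: "nat \<Rightarrow> int_mpoly \<Rightarrow> int_mpoly poly" where
  "poly_in_var k P = (\<Sum>m\<in>Poly_Mapping.keys P.
     Polynomial.monom
       (Poly_Mapping.single (Poly_Mapping.update k 0 m) (Poly_Mapping.lookup P m))
       (Poly_Mapping.lookup m k))"

definition generic_poly :: "nat \<Rightarrow> int_mpoly poly" where
  "generic_poly n = (\<Sum>i\<le>n. Polynomial.monom (indet i) i)"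

definition generic_disc :: "nat \<Rightarrow> int_mpoly" where
  "generic_disc n = disc (generic_poly n)"

definition double_disc :: "nat \<Rightarrow> nat \<Rightarrow> int_mpoly" where
  "double_disc n k = disc (poly_in_var k (generic_disc n))"

end

theory Submission
  imports Defs "Jordan_Normal_Form.Determinant"
begin

text \<open>
  The discriminant of \<open>p\<close> is, up to sign, the determinant of the Sylvester matrix of \<open>p'\<close> and
  \<open>p\<close> with the leading coefficient of \<open>p\<close> divided out of its last column; in particular it is an
  integer polynomial in the coefficients. For \<open>p = f\<close> the two columns of low degree contain
  \<open>a\<^sub>0\<close> and \<open>a\<^sub>1\<close> in such a way that \<open>D\<^sub>n\<close> lies in the ideal
  \<open>(a\<^sub>0, a\<^sub>1\<^sup>2)\<close>: modulo \<open>a\<^sub>0\<close>, \<open>D\<^sub>n\<close> has a double root at \<open>a\<^sub>1 = 0\<close>. Hence the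
  coefficients of \<open>1\<close> and \<open>a\<^sub>1\<close> in \<open>D\<^sub>n\<close> are divisible by \<open>a\<^sub>0\<close>, and these fill the first column of
  the matrix whose determinant is \<open>DD\<^sub>n\<^sub>,\<^sub>1\<close>. The degree of \<open>D\<^sub>n\<close> in \<open>a\<^sub>1\<close> is at least 2
  (so that this column is not the modified one), because \<open>D\<^sub>n\<close> does not vanish at
  \<open>f = x (x - 1) \<cdots> (x - n + 1)\<close>, where \<open>a\<^sub>0 = 0\<close>.
\<close>

subsection \<open>Sylvester determinants and products over roots\<close>

text \<open>
  Row \<open>i < n\<close> holds the coefficients of \<open>x\<^sup>i p'\<close> and row \<open>n + i\<close> those of \<open>x\<^sup>i p\<close>, in ascending
  order, where \<open>p = \<Sum>i\<le>n. c i * x\<^sup>i\<close>; the last column is divided by \<open>c n\<close>.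
\<close>
definition red_sylvester :: "nat \<Rightarrow> (nat \<Rightarrow> 'a::comm_ring_1) \<Rightarrow> 'a mat" where
  "red_sylvester n c = mat (2 * n - 1) (2 * n - 1) (\<lambda>(i, j).
     if j = 2 * n - 2 then (if i = n - 1 then of_nat n else if i = 2 * n - 2 then 1 else 0)
     else if i < n then (if i \<le> j then of_nat (Suc (j - i)) * c (Suc (j - i)) else 0)
     else (if i - n \<le> j then c (j - (i - n)) else 0))"

text \<open>The exponent is n(n-1)/2, written as the number of factors in the root product so that
  the signs match termwise. The entries need only a commutative ring, so \<open>discr\<close> makes
  sense before any roots exist.\<close>

definition discr :: "nat \<Rightarrow> (nat \<Rightarrow> 'a::comm_ring_1) \<Rightarrow> 'a" where
  "discr n c = (-1) ^ card {(i, j). i < j \<and> j < n} * det (red_sylvester n c)"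

text \<open>The undivided Sylvester matrix. Entries are read off from actual polynomials, so that
  multiplying a row by the powers of x amounts to evaluation at x.\<close>

definition sylvester_pderiv :: "nat \<Rightarrow> 'a::idom poly \<Rightarrow> 'a mat" where
  "sylvester_pderiv n f = mat (2 * n - 1) (2 * n - 1) (\<lambda>(i, j).
     Polynomial.coeff (if i < n then Polynomial.monom 1 i * pderiv f
                       else Polynomial.monom 1 (i - n) * f) j)"

lemma red_sylvester_carrier [simp]:
  "red_sylvester n c \<in> carrier_mat (2 * n - 1) (2 * n - 1)"
  by (simp add: red_sylvester_def)

lemma sylvester_pderiv_carrier [simp]:
  "sylvester_pderiv n f \<in> carrier_mat (2 * n - 1) (2 * n - 1)"
  by (simp add: sylvester_pderiv_def)

text \<open>In the last column only the top shifts of \<open>pderiv f\<close> and \<open>f\<close>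
  can be nonzero, and both entries are multiples of the coefficient of x^n, which can be pulled
  out.\<close>

lemma det_sylvester_pderiv:
  fixes f :: "'a::idom poly"
  assumes n: "n \<ge> 1" and deg: "Polynomial.degree f \<le> n"
  shows "det (sylvester_pderiv n f) =
           Polynomial.coeff f n * det (red_sylvester n (Polynomial.coeff f))"
proof -
  let ?N = "2 * n - 1" and ?l = "2 * n - 2" and ?c = "Polynomial.coeff f"
  have z: "?c k = 0" if "k > n" for k
    using that deg by (simp add: coeff_eq_0)
  have N: "0 < ?N" "?l < ?N" "\<And>k. k < ?N \<longleftrightarrow> k \<le> ?l" using n by auto
  \<comment> \<open>Multiplication by this diagonal matrix from the right rescales the last column,
    which avoids dividing in the ring.\<close>
  define D :: "'a mat" where "D = multrow_mat ?N ?l (?c n)"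
  have "sylvester_pderiv n f = red_sylvester n ?c * D"
  proof (rule eq_matI)
    fix i j assume "i < dim_row (red_sylvester n ?c * D)" "j < dim_col (red_sylvester n ?c * D)"
    then have ij: "i < ?N" "j < ?N" by (auto simp: D_def red_sylvester_def)
    have "(red_sylvester n ?c * D) $$ (i, j) =
            (\<Sum>k\<in>{0..<?N}. red_sylvester n ?c $$ (i, k) * D $$ (k, j))"
      using ij by (simp add: scalar_prod_def D_def red_sylvester_def)
    also have "\<dots> = (\<Sum>k\<in>{0..<?N}. if k = j then
        red_sylvester n ?c $$ (i, j) * (if j = ?l then ?c n else 1) else 0)"
      by (rule sum.cong) (use ij in \<open>auto simp: D_def\<close>)
    also have "\<dots> = red_sylvester n ?c $$ (i, j) * (if j = ?l then ?c n else 1)"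
      using ij by simp
    also have "\<dots> = sylvester_pderiv n f $$ (i, j)"
    proof (cases "j = ?l")
      case False
      then show ?thesis using ij
        by (auto simp: red_sylvester_def sylvester_pderiv_def coeff_monom_mult coeff_pderiv)
    next
      case True
      \<comment> \<open>Rows \<open>n - 1\<close> and \<open>2 * n - 2\<close> hold x^(n-1) f' and
        x^(n-2) f, the only shifts that reach degree 2n-2. For n = 1 the two indices agree and the
        row belongs to f'.\<close>
      consider "i < n - 1" | "i = n - 1" | "n \<le> i" "i < ?l" | "n \<le> i" "i = ?l" using ij by linarith
      then show ?thesis
      proof cases
        case 1
        then have "Suc (?l - i) > n" by auto
        then have "?c (Suc (?l - i)) = 0" by (rule z)
        then show ?thesis using 1 ij True
          by (auto simp: red_sylvester_def sylvester_pderiv_def coeff_monom_mult coeff_pderiv)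
      next
        case 2
        then have "Suc (?l - i) = n" "i < n" "i \<le> ?l" using n by auto
        then show ?thesis using 2 ij True
          by (auto simp: red_sylvester_def sylvester_pderiv_def coeff_monom_mult coeff_pderiv
                   simp del: of_nat_Suc)
      next
        case 3
        then have "?l - (i - n) > n" "i \<noteq> n - 1" by auto
        then have "?c (?l - (i - n)) = 0" by (intro z)
        then show ?thesis using 3 ij True \<open>i \<noteq> n - 1\<close>
          by (auto simp: red_sylvester_def sylvester_pderiv_def coeff_monom_mult)
      next
        case 4
        then have "?l - (i - n) = n" "i \<noteq> n - 1" "i - n \<le> ?l" using n by auto
        then show ?thesis using 4 ij True
          by (auto simp: red_sylvester_def sylvester_pderiv_def coeff_monom_mult)
      qed
    qed
    finally show "sylvester_pderiv n f $$ (i, j) = (red_sylvester n ?c * D) $$ (i, j)" ..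
  qed (auto simp: D_def red_sylvester_def sylvester_pderiv_def)
  moreover have "D \<in> carrier_mat ?N ?N" by (simp add: D_def)
  ultimately have "det (sylvester_pderiv n f) = det (red_sylvester n ?c) * det D"
    by (simp add: det_mult[OF red_sylvester_carrier])
  then show ?thesis using N by (simp add: D_def det_multrow_mat)
qed

section \<open>Rows of the Sylvester matrix as polynomial values\<close>

lemma poly_eq_sum_lessThan:
  fixes p :: "'a::comm_semiring_1 poly"
  assumes "Polynomial.degree p < N"
  shows "poly p x = (\<Sum>k<N. Polynomial.coeff p k * x ^ k)"
  unfolding poly_altdef
  by (rule sum.mono_neutral_left) (use assms in \<open>auto simp: coeff_eq_0\<close>)

lemma degree_pderiv_le_diff:
  fixes f :: "'a::idom poly"
  assumes "Polynomial.degree f \<le> n"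
  shows "Polynomial.degree (pderiv f) \<le> n - 1"
  by (rule degree_le) (use assms in \<open>auto simp: coeff_pderiv coeff_eq_0\<close>)

lemma sylvester_pderiv_mult_powers:
  fixes f :: "'a::idom poly"
  assumes "n \<ge> 1" "Polynomial.degree f \<le> n" "i < 2 * n - 1"
  shows "(\<Sum>k<2 * n - 1. sylvester_pderiv n f $$ (i, k) * x ^ k) =
           (if i < n then x ^ i * poly (pderiv f) x else x ^ (i - n) * poly f x)"
proof -
  let ?p = "if i < n then Polynomial.monom 1 i * pderiv f else Polynomial.monom 1 (i - n) * f"
  have "Polynomial.degree ?p < 2 * n - 1"
  proof (cases "i < n")
    case True
    have "Polynomial.degree (Polynomial.monom 1 i * pderiv f) \<le> i + Polynomial.degree (pderiv f)"
      by (rule order.trans[OF degree_mult_le]) (simp add: degree_monom_le)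
    also have "\<dots> \<le> i + (n - 1)" using degree_pderiv_le_diff[OF assms(2)] by simp
    finally show ?thesis using True by simp
  next
    case False
    have "Polynomial.degree (Polynomial.monom 1 (i - n) * f) \<le> (i - n) + Polynomial.degree f"
      by (rule order.trans[OF degree_mult_le]) (simp add: degree_monom_le)
    then show ?thesis using False assms by simp
  qed
  then have "poly ?p x = (\<Sum>k<2 * n - 1. Polynomial.coeff ?p k * x ^ k)"
    by (rule poly_eq_sum_lessThan)
  then show ?thesis using assms
    by (simp add: sylvester_pderiv_def poly_monom cong: if_cong split: if_splits)
qed

text \<open>A kernel vector of the transpose would be the coefficient vector of a nonzero polynomial
  of degree below n with n distinct roots. The result allows the Vandermonde factor to be cancelled
  below.\<close>

lemma det_vandermonde_nonzero:
  fixes r :: "nat \<Rightarrow> 'a::idom"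
  assumes inj: "inj_on r {..<n}"
  shows "det (mat n n (\<lambda>(i, j). r j ^ i)) \<noteq> 0"
proof
  let ?V = "mat n n (\<lambda>(i, j). r j ^ i)"
  assume "det ?V = 0"
  then have "det (transpose_mat ?V) = 0" by (subst det_transpose[of _ n]) auto
  then obtain v where v: "v \<in> carrier_vec n" "v \<noteq> 0\<^sub>v n" "transpose_mat ?V *\<^sub>v v = 0\<^sub>v n"
    using det_0_iff_vec_prod_zero[of "transpose_mat ?V" n] by auto
  define p where "p = (\<Sum>k<n. Polynomial.monom (v $ k) k)"
  have coeff: "Polynomial.coeff p k = (if k < n then v $ k else 0)" for k
    by (simp add: p_def coeff_sum)
  have "poly p (r j) = 0" if j: "j < n" for j
  proof -
    have "poly p (r j) = (\<Sum>k\<in>{0..<n}. v $ k * r j ^ k)"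
      by (simp add: p_def poly_sum poly_monom atLeast0LessThan)
    also have "\<dots> = (transpose_mat ?V *\<^sub>v v) $ j"
      using j v(1) by (auto simp: scalar_prod_def mult.commute intro!: sum.cong)
    finally show ?thesis using v(3) j by simp
  qed
  then have sub: "r ` {..<n} \<subseteq> {x. poly p x = 0}" by auto
  obtain k where "k < n" "v $ k \<noteq> 0" using v(1,2) by (auto simp: vec_eq_iff)
  then have p0: "p \<noteq> 0" and n0: "n > 0" using coeff[of k] by auto
  have "n = card (r ` {..<n})" using inj by (simp add: card_image)
  also have "\<dots> \<le> card {x. poly p x = 0}" by (intro card_mono sub poly_roots_finite p0)
  also have "\<dots> \<le> Polynomial.degree p" by (rule card_poly_roots_bound[OF p0])
  also have "\<dots> < n" using n0 coeff by (intro degree_lessI) auto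
  finally show False by simp
qed

text \<open>
  Multiplying by the matrix whose first \<open>n\<close> columns are the powers of the roots and whose other
  columns are unit vectors makes the Sylvester matrix block triangular.
\<close>
lemma det_sylvester_pderiv_distinct:
  fixes f :: "'a::idom poly" and r :: "nat \<Rightarrow> 'a"
  assumes n: "n \<ge> 1" and deg: "Polynomial.degree f \<le> n"
    and roots: "\<And>j. j < n \<Longrightarrow> poly f (r j) = 0" and inj: "inj_on r {..<n}"
  shows "det (sylvester_pderiv n f) =
           Polynomial.coeff f n ^ (n - 1) * (\<Prod>j<n. poly (pderiv f) (r j))"
proof -
  let ?N = "2 * n - 1" and ?S = "sylvester_pderiv n f"
  let ?V = "mat n n (\<lambda>(i, j). r j ^ i)"
  let ?W = "four_block_mat ?V (0\<^sub>m n (n - 1)) (mat (n - 1) n (\<lambda>(i, j). r j ^ (i + n))) (1\<^sub>m (n - 1))"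
  let ?X = "mat n n (\<lambda>(i, j). r j ^ i * poly (pderiv f) (r j))"
  let ?E = "mat n n (\<lambda>(i, j). if i = j then poly (pderiv f) (r j) else 0)"
  let ?C = "mat n (n - 1) (\<lambda>(i, j). ?S $$ (i, j + n))"
  let ?T = "mat (n - 1) (n - 1) (\<lambda>(i, j). ?S $$ (i + n, j + n))"
  have N: "n + (n - 1) = ?N" "n + n - 1 = ?N" using n by auto
  have SW: "?S * ?W = four_block_mat ?X ?C (0\<^sub>m (n - 1) n) ?T"
  proof (rule eq_matI)
    fix i j assume "i < dim_row (four_block_mat ?X ?C (0\<^sub>m (n - 1) n) ?T)"
      "j < dim_col (four_block_mat ?X ?C (0\<^sub>m (n - 1) n) ?T)"
    then have ij: "i < ?N" "j < ?N" using N by auto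
    have "(?S * ?W) $$ (i, j) = (\<Sum>k<?N. ?S $$ (i, k) * ?W $$ (k, j))"
      using ij N by (simp add: scalar_prod_def sylvester_pderiv_def atLeast0LessThan)
    also have "\<dots> = four_block_mat ?X ?C (0\<^sub>m (n - 1) n) ?T $$ (i, j)"
    proof (cases "j < n")
      case True
      have "(\<Sum>k<?N. ?S $$ (i, k) * ?W $$ (k, j)) = (\<Sum>k<?N. ?S $$ (i, k) * r j ^ k)"
        using True N ij by (intro sum.cong) auto
      also have "\<dots> = (if i < n then r j ^ i * poly (pderiv f) (r j)
                       else r j ^ (i - n) * poly f (r j))"
        by (rule sylvester_pderiv_mult_powers[OF n deg ij(1)])
      finally show ?thesis using True ij N roots by auto
    next
      case False
      have "(\<Sum>k<?N. ?S $$ (i, k) * ?W $$ (k, j)) = (\<Sum>k<?N. if k = j then ?S $$ (i, j) else 0)"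
        using False N ij by (intro sum.cong) auto
      then show ?thesis using False ij N by auto
    qed
    finally show "(?S * ?W) $$ (i, j) = four_block_mat ?X ?C (0\<^sub>m (n - 1) n) ?T $$ (i, j)" .
  qed (use N in \<open>auto simp: sylvester_pderiv_def\<close>)
  have W: "?W \<in> carrier_mat ?N ?N" using N by (intro carrier_matI) auto
  have XE: "?X = ?V * ?E"
    by (rule eq_matI) (auto simp: scalar_prod_def if_distrib cong: if_cong)
  have detE: "det ?E = (\<Prod>j<n. poly (pderiv f) (r j))"
    by (subst det_upper_triangular[of _ n])
       (auto simp: prod_list_diag_prod atLeast0LessThan upper_triangular_def)
  \<comment> \<open>Entry (i, j) of \<open>?T\<close> is the coefficient of f at n + j - i, which
    vanishes for j > i.\<close>
  have detT: "det ?T = Polynomial.coeff f n ^ (n - 1)"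
    by (subst det_lower_triangular[of "n - 1"])
       (use deg in \<open>auto simp: prod_list_diag_prod sylvester_pderiv_def coeff_monom_mult coeff_eq_0\<close>)
  \<comment> \<open>The identity block of \<open>?W\<close> gives det \<open>?W\<close> = det
    \<open>?V\<close>; on the other side \<open>?X\<close> contributes the same factor, which then
    cancels.\<close>
  have "det ?S * det ?V = det ?S * det ?W"
    by (subst det_four_block_mat_upper_right_zero[of _ n _ "n - 1"]) auto
  also have "\<dots> = det (?S * ?W)"
    by (rule det_mult[symmetric, OF sylvester_pderiv_carrier W])
  also have "\<dots> = det ?X * det ?T"
    unfolding SW by (subst det_four_block_mat_lower_left_zero[of _ n _ "n - 1"]) auto
  also have "det ?X = det ?V * det ?E"
    unfolding XE by (rule det_mult[of _ n]) auto
  finally show ?thesis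
    using det_vandermonde_nonzero[OF inj] unfolding detE detT by (simp add: mult_ac)
qed

text \<open>Every row encodes a multiple of f or f', so the vector of powers of the common root x
  lies in the kernel. It is nonzero since its entry 0 is 1.\<close>

lemma det_sylvester_pderiv_multiple_root:
  fixes f :: "'a::idom poly"
  assumes n: "n \<ge> 1" and deg: "Polynomial.degree f \<le> n"
    and "poly f x = 0" "poly (pderiv f) x = 0"
  shows "det (sylvester_pderiv n f) = 0"
proof -
  let ?N = "2 * n - 1" and ?v = "vec (2 * n - 1) (\<lambda>k. x ^ k)"
  have "sylvester_pderiv n f *\<^sub>v ?v = 0\<^sub>v ?N"
  proof (rule eq_vecI)
    fix i assume "i < dim_vec (0\<^sub>v ?N :: 'a vec)"
    then have i: "i < ?N" by simp
    then have "(sylvester_pderiv n f *\<^sub>v ?v) $ i =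
        (\<Sum>k<?N. sylvester_pderiv n f $$ (i, k) * x ^ k)"
      by (simp add: scalar_prod_def sylvester_pderiv_def atLeast0LessThan)
    then show "(sylvester_pderiv n f *\<^sub>v ?v) $ i = 0\<^sub>v ?N $ i"
      using sylvester_pderiv_mult_powers[OF n deg i, of x] assms(3,4) i by simp
  qed (simp add: sylvester_pderiv_def)
  moreover have "?v $ 0 \<noteq> 0\<^sub>v ?N $ 0" using n by simp
  then have "?v \<noteq> 0\<^sub>v ?N" by metis
  moreover have "?v \<in> carrier_vec ?N" by simp
  ultimately show ?thesis
    unfolding det_0_iff_vec_prod_zero[OF sylvester_pderiv_carrier] by blast
qed

text \<open>The ordered pairs (i, j) and (j, i) together contribute -(r i - r j)^2.\<close>

lemma prod_off_diagonal:
  fixes r :: "nat \<Rightarrow> 'a::comm_ring_1"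
  shows "(\<Prod>i<n. \<Prod>j\<in>{..<n} - {i}. r i - r j) =
    (-1) ^ card {(i, j). i < j \<and> j < n} * (\<Prod>(i, j)\<in>{(i, j). i < j \<and> j < n}. (r i - r j)\<^sup>2)"
proof -
  let ?P = "{(i, j). i < j \<and> j < n}"
  have fin: "finite ?P" by (rule finite_subset[of _ "{..<n} \<times> {..<n}"]) auto
  have "(\<Prod>i<n. \<Prod>j\<in>{..<n} - {i}. r i - r j) =
      (\<Prod>(i, j)\<in>(SIGMA i:{..<n}. {..<n} - {i}). r i - r j)"
    by (simp add: prod.Sigma)
  also have "(SIGMA i:{..<n}. {..<n} - {i}) = ?P \<union> prod.swap ` ?P"
    by (auto simp: image_iff)
  also have "(\<Prod>(i, j)\<in>?P \<union> prod.swap ` ?P. r i - r j) =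
      (\<Prod>(i, j)\<in>?P. r i - r j) * (\<Prod>(i, j)\<in>prod.swap ` ?P. r i - r j)"
    by (rule prod.union_disjoint) (use fin in auto)
  also have "(\<Prod>(i, j)\<in>prod.swap ` ?P. r i - r j) = (\<Prod>(i, j)\<in>?P. r j - r i)"
    by (subst prod.reindex) (auto intro!: prod.cong)
  also have "(\<Prod>(i, j)\<in>?P. r i - r j) * (\<Prod>(i, j)\<in>?P. r j - r i) =
      (\<Prod>(i, j)\<in>?P. (-1) * (r i - r j)\<^sup>2)"
    by (subst prod.distrib[symmetric]) (auto intro!: prod.cong simp: power2_eq_square algebra_simps)
  also have "\<dots> = (\<Prod>x\<in>?P. (-1) * (case x of (i, j) \<Rightarrow> (r i - r j)\<^sup>2))"
    by (rule prod.cong) auto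
  also have "\<dots> = (-1) ^ card ?P * (\<Prod>(i, j)\<in>?P. (r i - r j)\<^sup>2)"
    by (subst prod.distrib) simp
  finally show ?thesis .
qed

text \<open>For distinct roots this is the Vandermonde computation together with the product rule
  for f'. For a repeated root both sides are zero.\<close>

lemma discr_eq_prod_roots:
  fixes r :: "nat \<Rightarrow> 'a::idom"
  assumes n: "n \<ge> 1" and a: "a \<noteq> 0"
    and f: "f = Polynomial.smult a (\<Prod>i<n. [:- r i, 1:])"
  shows "discr n (Polynomial.coeff f) =
    a ^ (2 * n - 2) * (\<Prod>(i, j)\<in>{(i, j). i < j \<and> j < n}. (r i - r j)\<^sup>2)"
proof -
  let ?P = "{(i, j). i < j \<and> j < n}"
  let ?d = "\<Prod>(i, j)\<in>?P. (r i - r j)\<^sup>2"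
  have fin: "finite ?P" by (rule finite_subset[of _ "{..<n} \<times> {..<n}"]) auto
  have deg: "Polynomial.degree f = n"
    using a by (simp add: f degree_prod_eq_sum_degree)
  have lc: "Polynomial.coeff f n = a"
  proof -
    have "Polynomial.lead_coeff f = a" by (simp add: f lead_coeff_prod)
    then show ?thesis by (simp add: deg)
  qed
  have root: "poly f (r i) = 0" if "i < n" for i
    using that by (auto simp: f poly_prod)
  have deriv: "poly (pderiv f) (r i) = a * (\<Prod>j\<in>{..<n} - {i}. r i - r j)" if i: "i < n" for i
  proof -
    have "poly (pderiv f) (r i) =
        a * (\<Sum>k<n. (\<Prod>j\<in>{..<n} - {k}. r i - r j))"
      by (simp add: f pderiv_smult pderiv_prod poly_sum poly_prod pderiv_pCons)
    \<comment> \<open>Each summand with k different from i contains the factor r i - r i.\<close>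
    also have "(\<Sum>k<n. (\<Prod>j\<in>{..<n} - {k}. r i - r j)) =
        (\<Sum>k<n. if k = i then (\<Prod>j\<in>{..<n} - {i}. r i - r j) else 0)"
      by (rule sum.cong) (use i in \<open>auto intro!: prod_zero\<close>)
    finally show ?thesis using i by simp
  qed
  \<comment> \<open>The extra factor a turns the reduced determinant into the full Sylvester one; it
    is cancelled at the end.\<close>
  have "a * det (red_sylvester n (Polynomial.coeff f)) = a ^ (2 * n - 1) * ((-1) ^ card ?P * ?d)"
  proof (cases "inj_on r {..<n}")
    case True
    have "a * det (red_sylvester n (Polynomial.coeff f)) = det (sylvester_pderiv n f)"
      using det_sylvester_pderiv[OF n, of f] deg lc by simp
    also have "\<dots> = a ^ (n - 1) * (\<Prod>j<n. poly (pderiv f) (r j))"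
      using det_sylvester_pderiv_distinct[OF n _ root True] deg lc by simp
    also have "(\<Prod>j<n. poly (pderiv f) (r j)) = (\<Prod>i<n. a * (\<Prod>j\<in>{..<n} - {i}. r i - r j))"
      by (rule prod.cong) (simp_all add: deriv)
    also have "\<dots> = a ^ n * ((-1) ^ card ?P * ?d)"
      by (simp add: prod.distrib prod_off_diagonal)
    also have "a ^ (n - 1) * (a ^ n * ((-1) ^ card ?P * ?d)) =
        a ^ (n - 1 + n) * ((-1) ^ card ?P * ?d)"
      by (simp add: power_add mult.assoc)
    also have "n - 1 + n = 2 * n - 1" using n by simp
    finally show ?thesis .
  next
    case False
    then obtain i j where "i < n" "j < n" "i \<noteq> j" "r i = r j" by (auto simp: inj_on_def)
    then obtain i j where ij: "i < j" "j < n" "r i = r j" by (metis linorder_neqE_nat)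
    then have i: "i < n" by simp
    have "poly (pderiv f) (r i) = 0"
      using ij i by (subst deriv) (auto intro!: prod_zero)
    then have "det (sylvester_pderiv n f) = 0"
      using det_sylvester_pderiv_multiple_root[OF n, of f "r i"] deg root[OF i] by simp
    then have "a * det (red_sylvester n (Polynomial.coeff f)) = 0"
      using det_sylvester_pderiv[OF n, of f] deg lc by simp
    moreover have "?d = 0" using ij fin by (intro prod_zero) (auto intro!: bexI[of _ "(i, j)"])
    ultimately show ?thesis by simp
  qed
  also have "a ^ (2 * n - 1) = a * a ^ (2 * n - 2)"
  proof -
    have "2 * n - 1 = Suc (2 * n - 2)" using n by simp
    then show ?thesis by simp
  qed
  finally have "det (red_sylvester n (Polynomial.coeff f)) =
      a ^ (2 * n - 2) * ((-1) ^ card ?P * ?d)"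
    using a by (simp add: mult.assoc)
  then show ?thesis by (simp add: discr_def flip: power_mult_distrib mult.assoc)
qed

subsection \<open>The discriminant as a determinant\<close>

lemma to_closure_hom: "comm_ring_hom (to_closure :: 'a::idom \<Rightarrow> _)"
  by unfold_locales (simp_all add: to_closure_def)

lemma to_closure_eq_iff [simp]: "to_closure x = to_closure y \<longleftrightarrow> x = y"
  by (simp add: to_closure_def)

lemma to_closure_0 [simp]: "to_closure 0 = 0"
  by (simp add: to_closure_def)

lemma to_closure_eq_0_iff [simp]: "to_closure x = 0 \<longleftrightarrow> x = 0"
  using to_closure_eq_iff[of x 0] by (simp del: to_closure_eq_iff)

text \<open>The entries of the matrix are integer multiples of the c i or integer constants. This
  moves \<open>discr\<close> to the algebraic closure and, later, to numerical
  specializations.\<close>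

lemma (in comm_ring_hom) hom_discr: "hom (discr n c) = discr n (\<lambda>i. hom (c i))"
proof -
  have "map_mat hom (red_sylvester n c) = red_sylvester n (\<lambda>i. hom (c i))"
    by (rule eq_matI) (auto simp: red_sylvester_def hom_distribs)
  then show ?thesis by (simp add: discr_def hom_distribs flip: hom_det)
qed

text \<open>Without a root list the condition defining \<open>disc\<close> would hold vacuously for
  every d; its existence gives uniqueness.\<close>

lemma exists_root_list:
  fixes p :: "'a::idom poly"
  assumes "p \<noteq> 0"
  shows "\<exists>rs. is_root_list p rs"
proof -
  have lc: "Polynomial.lead_coeff (map_poly to_closure p) = to_closure (Polynomial.lead_coeff p)"
    by (simp add: coeff_map_poly degree_map_poly)
  obtain A where "map_poly to_closure p =
      Polynomial.smult (to_closure (Polynomial.lead_coeff p)) (\<Prod>x\<in>#A. [:- x, 1:])"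
    using alg_closed_imp_factorization[of "map_poly to_closure p"] assms unfolding lc
    by (auto simp: map_poly_eq_0_iff)
  moreover obtain rs where "A = mset rs" by (metis ex_mset)
  ultimately have "is_root_list p rs"
    by (simp add: is_root_list_def flip: prod_mset_prod_list)
  then show ?thesis ..
qed

text \<open>The product formula holds over the closure, and injectivity of \<open>to_closure\<close>
  brings it back to the domain.\<close>

lemma disc_eq_discr:
  fixes p :: "'a::idom poly"
  assumes deg: "Polynomial.degree p = n" "n \<ge> 1"
  shows "disc p = discr n (Polynomial.coeff p)"
proof -
  interpret comm_ring_hom "to_closure :: 'a \<Rightarrow> _" by (rule to_closure_hom)
  have p0: "p \<noteq> 0" using deg by auto
  have prod_formula: "to_closure (discr n (Polynomial.coeff p)) =
       to_closure (Polynomial.lead_coeff p) ^ (2 * Polynomial.degree p - 2) *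
       (\<Prod>(i, j)\<in>{(i, j). i < j \<and> j < length rs}. (rs ! i - rs ! j)\<^sup>2)"
    if "is_root_list p rs" for rs
  proof -
    let ?a = "to_closure (Polynomial.lead_coeff p)"
    have a: "?a \<noteq> 0" using p0 by (metis leading_coeff_neq_0 to_closure_0 to_closure_eq_iff)
    have f: "map_poly to_closure p = Polynomial.smult ?a (\<Prod>i<length rs. [:- (rs ! i), 1:])"
      using that by (simp add: is_root_list_def prod.list_conv_set_nth atLeast0LessThan)
    have "Polynomial.degree (map_poly to_closure p) = length rs"
      unfolding f using a by (simp add: degree_prod_eq_sum_degree)
    then have len: "length rs = n" using deg by (simp add: degree_map_poly)
    have "(\<lambda>i. to_closure (Polynomial.coeff p i)) = Polynomial.coeff (map_poly to_closure p)"
      by (simp add: fun_eq_iff coeff_map_poly)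
    then have "to_closure (discr n (Polynomial.coeff p)) =
        discr n (Polynomial.coeff (map_poly to_closure p))"
      by (simp add: hom_discr)
    also have "\<dots> = ?a ^ (2 * n - 2) * (\<Prod>(i, j)\<in>{(i, j). i < j \<and> j < n}. (rs ! i - rs ! j)\<^sup>2)"
      by (rule discr_eq_prod_roots[OF deg(2) a]) (use f len in simp)
    finally show ?thesis using deg len by simp
  qed
  obtain rs where rs: "is_root_list p rs" using exists_root_list[OF p0] by blast
  show ?thesis unfolding disc_def
  proof (rule the_equality)
    fix d
    assume "\<forall>rs. is_root_list p rs \<longrightarrow> to_closure d =
      to_closure (Polynomial.lead_coeff p) ^ (2 * Polynomial.degree p - 2) *
      (\<Prod>(i, j)\<in>{(i, j). i < j \<and> j < length rs}. (rs ! i - rs ! j)\<^sup>2)"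
    with rs prod_formula[OF rs] have "to_closure d = to_closure (discr n (Polynomial.coeff p))"
      by (simp only:)
    then show "d = discr n (Polynomial.coeff p)" by simp
  qed (blast intro: prod_formula)
qed

subsection \<open>Evaluation and supports of integer polynomials\<close>

definition eval_monom :: "(nat \<Rightarrow> 'a::comm_ring_1) \<Rightarrow> (nat \<Rightarrow>\<^sub>0 nat) \<Rightarrow> 'a" where
  "eval_monom v m = (\<Prod>i\<in>Poly_Mapping.keys m. v i ^ Poly_Mapping.lookup m i)"

definition eval_mpoly :: "(nat \<Rightarrow> 'a::comm_ring_1) \<Rightarrow> int_mpoly \<Rightarrow> 'a" where
  "eval_mpoly v P = (\<Sum>m\<in>Poly_Mapping.keys P. of_int (Poly_Mapping.lookup P m) * eval_monom v m)"

lemma eval_monom_superset: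
  assumes "finite A" "Poly_Mapping.keys m \<subseteq> A"
  shows "eval_monom v m = (\<Prod>i\<in>A. v i ^ Poly_Mapping.lookup m i)"
  unfolding eval_monom_def
  by (rule prod.mono_neutral_left) (use assms in \<open>auto simp: in_keys_iff\<close>)

lemma eval_monom_add: "eval_monom v (m + m') = eval_monom v m * eval_monom v m'"
proof -
  let ?A = "Poly_Mapping.keys m \<union> Poly_Mapping.keys m'"
  have "Poly_Mapping.keys (m + m') \<subseteq> ?A" by (rule keys_add)
  then show ?thesis
    by (simp add: eval_monom_superset[of ?A] lookup_add power_add prod.distrib)
qed

lemma eval_mpoly_superset:
  assumes "finite A" "Poly_Mapping.keys P \<subseteq> A"
  shows "eval_mpoly v P = (\<Sum>m\<in>A. of_int (Poly_Mapping.lookup P m) * eval_monom v m)"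
  unfolding eval_mpoly_def
  by (rule sum.mono_neutral_left) (use assms in \<open>auto simp: in_keys_iff\<close>)

lemma eval_mpoly_add: "eval_mpoly v (P + Q) = eval_mpoly v P + eval_mpoly v Q"
proof -
  let ?A = "Poly_Mapping.keys P \<union> Poly_Mapping.keys Q"
  have "Poly_Mapping.keys (P + Q) \<subseteq> ?A" by (rule keys_add)
  then show ?thesis
    by (simp add: eval_mpoly_superset[of ?A] lookup_add distrib_right sum.distrib)
qed

lemma eval_mpoly_0 [simp]: "eval_mpoly v 0 = 0"
  by (simp add: eval_mpoly_def)

lemma eval_mpoly_single [simp]:
  "eval_mpoly v (Poly_Mapping.single m c) = of_int c * eval_monom v m"
  by (simp add: eval_mpoly_def)

lemma eval_mpoly_sum: "eval_mpoly v (sum f A) = (\<Sum>x\<in>A. eval_mpoly v (f x))"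
  by (induction A rule: infinite_finite_induct) (simp_all add: eval_mpoly_add)

lemma mpoly_eq_sum_single:
  fixes P :: "'a \<Rightarrow>\<^sub>0 'b::comm_monoid_add"
  shows "P = (\<Sum>m\<in>Poly_Mapping.keys P. Poly_Mapping.single m (Poly_Mapping.lookup P m))"
  by (rule poly_mapping_eqI)
     (simp add: lookup_sum lookup_single when_def in_keys_iff)

lemma eval_mpoly_mult: "eval_mpoly v (P * Q) = eval_mpoly v P * eval_mpoly v Q"
proof -
  have "P * Q = (\<Sum>m\<in>Poly_Mapping.keys P. \<Sum>m'\<in>Poly_Mapping.keys Q.
      Poly_Mapping.single (m + m') (Poly_Mapping.lookup P m * Poly_Mapping.lookup Q m'))"
    by (subst mpoly_eq_sum_single[of P], subst mpoly_eq_sum_single[of Q])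
       (simp only: sum_product mult_single)
  then have "eval_mpoly v (P * Q) = (\<Sum>m\<in>Poly_Mapping.keys P. \<Sum>m'\<in>Poly_Mapping.keys Q.
      (of_int (Poly_Mapping.lookup P m) * eval_monom v m) *
      (of_int (Poly_Mapping.lookup Q m') * eval_monom v m'))"
    by (simp add: eval_mpoly_sum eval_monom_add mult_ac)
  then show ?thesis by (simp add: eval_mpoly_def sum_product)
qed

lemma eval_mpoly_hom: "comm_ring_hom (eval_mpoly v)"
proof
  show "eval_mpoly v 1 = 1" by (simp add: eval_mpoly_def eval_monom_def)
qed (simp_all add: eval_mpoly_add eval_mpoly_mult)

lemma eval_mpoly_indet [simp]: "eval_mpoly v (indet i) = v i"
  by (simp add: indet_def eval_monom_def)

text \<open>Used in contrapositive form: a nonzero value at a point with v k = 0 exhibits a monomial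
  free of a_k.\<close>

lemma eval_mpoly_eq_0:
  assumes "v k = 0" "\<forall>m\<in>Poly_Mapping.keys P. Poly_Mapping.lookup m k > 0"
  shows "eval_mpoly v P = 0"
  unfolding eval_mpoly_def eval_monom_def
proof (rule sum.neutral, rule ballI)
  fix m assume "m \<in> Poly_Mapping.keys P"
  then have "Poly_Mapping.lookup m k > 0" using assms(2) by blast
  then have "k \<in> Poly_Mapping.keys m" "v k ^ Poly_Mapping.lookup m k = 0"
    using assms(1) by (simp_all add: in_keys_iff zero_power)
  then have "(\<Prod>i\<in>Poly_Mapping.keys m. v i ^ Poly_Mapping.lookup m i) = 0"
    by (intro prod_zero) auto
  then show "of_int (Poly_Mapping.lookup P m) *
      (\<Prod>i\<in>Poly_Mapping.keys m. v i ^ Poly_Mapping.lookup m i) = 0" by simp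
qed

text \<open>One notion for two uses: if U absorbs addition this is a monomial ideal, such as (a_k)
  for the exponents positive at k; if U bounds the variables it is \<open>polys_in\<close>.\<close>

definition supported_on :: "(nat \<Rightarrow>\<^sub>0 nat) set \<Rightarrow> int_mpoly set" where
  "supported_on U = {P. Poly_Mapping.keys P \<subseteq> U}"

section \<open>Closure properties of supports\<close>

lemma polys_in_eq_supported_on: "polys_in V = supported_on {m. Poly_Mapping.keys m \<subseteq> V}"
  by (auto simp: polys_in_def supported_on_def)

lemma supported_on_0 [simp]: "0 \<in> supported_on U"
  by (simp add: supported_on_def)

lemma supported_on_add: "P \<in> supported_on U \<Longrightarrow> Q \<in> supported_on U \<Longrightarrow> P + Q \<in> supported_on U"
  using keys_add[of P Q] by (auto simp: supported_on_def)

lemma supported_on_sum: "(\<And>x. x \<in> A \<Longrightarrow> f x \<in> supported_on U) \<Longrightarrow> sum f A \<in> supported_on U"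
  by (induction A rule: infinite_finite_induct) (simp_all add: supported_on_add)

lemma supported_on_mult:
  assumes "P \<in> supported_on U" "Q \<in> supported_on U'" "\<And>m m'. m \<in> U \<Longrightarrow> m' \<in> U' \<Longrightarrow> m + m' \<in> U''"
  shows "P * Q \<in> supported_on U''"
  using keys_mult[of P Q] assms by (fastforce simp: supported_on_def)

lemma supported_on_mult_ideal:
  assumes "P \<in> supported_on U" "\<And>m m'. m \<in> U \<Longrightarrow> m + m' \<in> U"
  shows "P * Q \<in> supported_on U"
  by (rule supported_on_mult[of P U Q UNIV]) (use assms in \<open>auto simp: supported_on_def\<close>)

lemma of_int_mult_supported_on:
  assumes "P \<in> supported_on U"
  shows "of_int c * P \<in> supported_on U"
proof -
  have "(of_int c :: int_mpoly) \<in> supported_on {0}"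
    unfolding single_of_int [symmetric] by (simp add: supported_on_def)
  then show ?thesis by (rule supported_on_mult[OF _ assms]) simp
qed

lemma of_nat_mult_supported_on: "P \<in> supported_on U \<Longrightarrow> of_nat k * P \<in> supported_on U"
  using of_int_mult_supported_on[of P U "int k"] by simp

lemma keys_add_nat: "Poly_Mapping.keys (m + m' :: nat \<Rightarrow>\<^sub>0 nat) = Poly_Mapping.keys m \<union> Poly_Mapping.keys m'"
  by (auto simp: in_keys_iff lookup_add)

lemma polys_in_mult: "P \<in> polys_in V \<Longrightarrow> Q \<in> polys_in V \<Longrightarrow> P * Q \<in> polys_in V"
  unfolding polys_in_eq_supported_on by (erule (1) supported_on_mult) (simp add: keys_add_nat)

lemma polys_in_prod: "(\<And>x. x \<in> A \<Longrightarrow> f x \<in> polys_in V) \<Longrightarrow> prod f A \<in> polys_in V"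
proof (induction A rule: infinite_finite_induct)
  case (infinite A)
  then show ?case by (simp add: polys_in_def)
next
  case empty
  then show ?case by (simp add: polys_in_def)
qed (simp_all add: polys_in_mult)

lemma lookup_coeff_poly_in_var:
  "Poly_Mapping.lookup (Polynomial.coeff (poly_in_var k P) e) m =
     (if Poly_Mapping.lookup m k = 0 then Poly_Mapping.lookup P (m + Poly_Mapping.single k e) else 0)"
proof -
  let ?m = "m + Poly_Mapping.single k e"
  \<comment> \<open>A monomial is determined by its exponent at k and its remaining part, so at most
    one summand survives and nothing cancels.\<close>
  have *: "Poly_Mapping.lookup x k = e \<and> Poly_Mapping.update k 0 x = m \<longleftrightarrow>
      Poly_Mapping.lookup m k = 0 \<and> x = ?m" for x
    by (auto simp: poly_mapping_eq_iff fun_eq_iff lookup_update lookup_add lookup_single when_def)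
  have "Poly_Mapping.lookup (Polynomial.coeff (poly_in_var k P) e) m =
      (\<Sum>x\<in>Poly_Mapping.keys P. if Poly_Mapping.lookup x k = e \<and> Poly_Mapping.update k 0 x = m
         then Poly_Mapping.lookup P x else 0)"
    unfolding poly_in_var_def coeff_sum lookup_sum
    by (rule sum.cong) (auto simp: lookup_single when_def)
  then show ?thesis by (auto simp: * in_keys_iff)
qed

lemma indet_factor:
  assumes "P \<in> polys_in V" "\<forall>m\<in>Poly_Mapping.keys P. Poly_Mapping.lookup m k > 0"
  shows "\<exists>Q\<in>polys_in V. P = indet k * Q"
proof -
  let ?e = "Poly_Mapping.single k (1::nat)"
  define Q where "Q = (\<Sum>m\<in>Poly_Mapping.keys P. Poly_Mapping.single (m - ?e) (Poly_Mapping.lookup P m))"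
  \<comment> \<open>Exponent subtraction truncates, but here the exponent at k is positive.\<close>
  have "?e + (m - ?e) = m" if "m \<in> Poly_Mapping.keys P" for m
  proof (rule poly_mapping_eqI)
    fix i show "Poly_Mapping.lookup (?e + (m - ?e)) i = Poly_Mapping.lookup m i"
      using assms(2) that by (auto simp: lookup_add lookup_minus lookup_single when_def)
  qed
  then have "indet k * Q = (\<Sum>m\<in>Poly_Mapping.keys P. Poly_Mapping.single m (Poly_Mapping.lookup P m))"
    unfolding Q_def indet_def sum_distrib_left by (intro sum.cong) (simp_all add: mult_single)
  then have "P = indet k * Q" using mpoly_eq_sum_single[of P] by simp
  moreover have "Q \<in> polys_in V"
    unfolding Q_def polys_in_eq_supported_on
  proof (rule supported_on_sum)
    fix m assume "m \<in> Poly_Mapping.keys P"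
    then have "Poly_Mapping.keys m \<subseteq> V" using assms(1) by (auto simp: polys_in_def)
    moreover have "Poly_Mapping.keys (m - ?e) \<subseteq> Poly_Mapping.keys m"
      by (auto simp: in_keys_iff lookup_minus)
    ultimately show "Poly_Mapping.single (m - ?e) (Poly_Mapping.lookup P m)
        \<in> supported_on {m. Poly_Mapping.keys m \<subseteq> V}"
      by (auto simp: supported_on_def)
  qed
  ultimately show ?thesis by blast
qed

section \<open>Supports of discriminants\<close>

lemma indet_supported_on: "indet k \<in> supported_on {m. Poly_Mapping.lookup m k > 0}"
  by (simp add: indet_def supported_on_def)

lemma supported_on_mono: "P \<in> supported_on U \<Longrightarrow> U \<subseteq> U' \<Longrightarrow> P \<in> supported_on U'"
  by (auto simp: supported_on_def)

text \<open>By the Leibniz expansion it suffices to control the product along each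
  permutation.\<close>

lemma discr_supported_on:
  assumes "\<And>p. p permutes {0..<2 * n - 1} \<Longrightarrow>
     (\<Prod>i = 0..<2 * n - 1. red_sylvester n c $$ (i, p i)) \<in> supported_on U"
  shows "discr n c \<in> supported_on U"
proof -
  have "det (red_sylvester n c) \<in> supported_on U"
    unfolding det_def'[OF red_sylvester_carrier]
    by (intro supported_on_sum of_int_mult_supported_on assms) simp
  from of_int_mult_supported_on[OF this, of "(-1) ^ card {(i, j). i < j \<and> j < n}"]
  show ?thesis by (simp add: discr_def)
qed

lemma polys_in_discr:
  assumes "\<And>i. c i \<in> polys_in V"
  shows "discr n c \<in> polys_in V"
  unfolding polys_in_eq_supported_on
proof (rule discr_supported_on)
  fix p assume p: "p permutes {0..<2 * n - 1}"
  have one: "1 \<in> polys_in V" and zero: "0 \<in> polys_in V" by (simp_all add: polys_in_def)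
  have "(\<Prod>i = 0..<2 * n - 1. red_sylvester n c $$ (i, p i)) \<in> polys_in V"
  proof (rule polys_in_prod)
    fix i assume i: "i \<in> {0..<2 * n - 1}"
    then have "p i < 2 * n - 1" using permutes_in_image[OF p, of i] by simp
    moreover have "of_nat k * Q \<in> polys_in V" if "Q \<in> polys_in V" for k Q
      using that of_nat_mult_supported_on unfolding polys_in_eq_supported_on by blast
    note this[OF assms] this[OF one, simplified]
    ultimately show "red_sylvester n c $$ (i, p i) \<in> polys_in V"
      using i one zero assms by (simp add: red_sylvester_def del: of_nat_Suc)
  qed
  then show "(\<Prod>i = 0..<2 * n - 1. red_sylvester n c $$ (i, p i))
      \<in> supported_on {m. Poly_Mapping.keys m \<subseteq> V}"
    by (simp add: polys_in_eq_supported_on)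
qed

subsection \<open>The generic discriminant and the double discriminant\<close>

lemma permutes_preimage:
  fixes N :: nat
  assumes "p permutes {0..<N}" "j < N"
  obtains i where "i < N" "p i = j"
proof -
  obtain i where i: "p i = j" using permutes_surj[OF assms(1)] by (metis surjD)
  have "i < N" using permutes_in_image[OF assms(1), of i] assms(2) i by simp
  then show thesis using i by (rule that)
qed

text \<open>Every Leibniz term takes a factor from column 0, whose only possibly nonzero entries are
  c 1 (row 0) and c 0 (row n). Since n is at least 2, this is not the reduced last column.\<close>

lemma discr_in_indet_ideal:
  assumes n: "n \<ge> 2"
    and c0: "c 0 \<in> supported_on {m. Poly_Mapping.lookup m k > 0}"
    and c1: "c 1 \<in> supported_on {m. Poly_Mapping.lookup m k > 0}"
  shows "discr n c \<in> supported_on {m. Poly_Mapping.lookup m k > 0}" (is "_ \<in> supported_on ?U")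
proof (rule discr_supported_on)
  fix p assume p: "p permutes {0..<2 * n - 1}"
  let ?A = "red_sylvester n c"
  obtain i where i: "i < 2 * n - 1" "p i = 0"
    using permutes_preimage[OF p, of 0] n by auto
  have "?A $$ (i, 0) \<in> supported_on ?U"
    using n i(1) c0 c1 by (auto simp: red_sylvester_def)
  moreover have "(\<Prod>i = 0..<2 * n - 1. ?A $$ (i, p i)) =
      ?A $$ (i, 0) * (\<Prod>i \<in> {0..<2 * n - 1} - {i}. ?A $$ (i, p i))"
    using i by (subst prod.remove[of _ i]) auto
  ultimately show "(\<Prod>i = 0..<2 * n - 1. ?A $$ (i, p i)) \<in> supported_on ?U"
    by (simp only:) (auto intro: supported_on_mult_ideal simp: lookup_add)
qed

text \<open>A term using c 0 or a zero entry in column 0 is in (a_k) already. Otherwise it uses c 1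
  from row 0, and then column 1 supplies a second factor in (a_k, a_l).\<close>

lemma discr_in_double_root_ideal:
  assumes n: "n \<ge> 2"
    and c0: "c 0 \<in> supported_on {m. Poly_Mapping.lookup m k > 0}"
    and c1: "c 1 \<in> supported_on {m. Poly_Mapping.lookup m l > 0}"
  shows "discr n c \<in> supported_on {m. Poly_Mapping.lookup m k > 0 \<or> Poly_Mapping.lookup m l \<ge> 2}"
    (is "_ \<in> supported_on ?U")
proof (rule discr_supported_on)
  fix p assume p: "p permutes {0..<2 * n - 1}"
  let ?A = "red_sylvester n c"
  let ?K = "{m :: nat \<Rightarrow>\<^sub>0 nat. Poly_Mapping.lookup m k > 0}"
  let ?KL = "{m :: nat \<Rightarrow>\<^sub>0 nat. Poly_Mapping.lookup m k > 0 \<or> Poly_Mapping.lookup m l > 0}"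
  obtain i where i: "i < 2 * n - 1" "p i = 0"
    using permutes_preimage[OF p, of 0] n by auto
  obtain j where j: "j < 2 * n - 1" "p j = 1"
  proof -
    have "1 < 2 * n - 1" using n by simp
    with p show thesis by (rule permutes_preimage) (rule that)
  qed
  have ij: "i \<noteq> j" using i j by auto
  have c0': "c 0 \<in> supported_on ?KL" and c1': "c 1 \<in> supported_on ?KL"
    using c0 c1 by (auto elim: supported_on_mono)
  have "?A $$ (i, 0) * ?A $$ (j, 1) \<in> supported_on ?U"
  proof (cases "i = 0")
    case True
    then have "?A $$ (i, 0) \<in> supported_on ?KL"
      using n c1' by (simp add: red_sylvester_def)
    moreover have "?A $$ (j, 1) \<in> supported_on ?KL"
    proof -
      \<comment> \<open>With row 0 taken, column 1 offers c 1 in rows 1 and n, c 0 in row n + 1 if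
        that exists, and zero elsewhere; the entry 2 * c 2 sits in row 0.\<close>
      have "j = 1 \<or> j > 1" using True ij by auto
      moreover have "j - n = 0 \<or> j - n = 1 \<or> j - n > 1" by auto
      ultimately show ?thesis
        using n j(1) c0' c1' by (auto simp: red_sylvester_def)
    qed
    ultimately show ?thesis by (rule supported_on_mult) (auto simp: lookup_add)
  next
    case False
    then have "?A $$ (i, 0) \<in> supported_on ?K"
      using n i(1) c0 by (auto simp: red_sylvester_def)
    then have "?A $$ (i, 0) * ?A $$ (j, 1) \<in> supported_on ?K"
      by (rule supported_on_mult_ideal) (auto simp: lookup_add)
    then show ?thesis by (rule supported_on_mono) auto
  qed
  moreover have "(\<Prod>i = 0..<2 * n - 1. ?A $$ (i, p i)) =
      (?A $$ (i, 0) * ?A $$ (j, 1)) * (\<Prod>i \<in> {0..<2 * n - 1} - {i} - {j}. ?A $$ (i, p i))"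
    using i j ij by (simp add: prod.remove[of _ i] prod.remove[of _ j] mult.assoc)
  moreover have "m + m' \<in> ?U" if "m \<in> ?U" for m m'
    using that by (auto simp: lookup_add)
  ultimately show "(\<Prod>i = 0..<2 * n - 1. ?A $$ (i, p i)) \<in> supported_on ?U"
    by (simp only: supported_on_mult_ideal)
qed

section \<open>The generic polynomial and the monomials of its discriminant\<close>

lemma coeff_generic_poly:
  "Polynomial.coeff (generic_poly n) i = (if i \<le> n then indet i else 0)"
  by (simp add: generic_poly_def coeff_sum)

lemma indet_neq_0 [simp]: "indet i \<noteq> 0"
proof
  assume "indet i = 0"
  then have "eval_mpoly (\<lambda>_. 1 :: int) (indet i) = 0" by simp
  then show False by simp
qed

lemma degree_generic_poly: "Polynomial.degree (generic_poly n) = n"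
  by (rule antisym) (auto intro!: degree_le le_degree simp: coeff_generic_poly)

lemma generic_disc_eq_discr:
  "n \<ge> 1 \<Longrightarrow> generic_disc n = discr n (Polynomial.coeff (generic_poly n))"
  unfolding generic_disc_def by (rule disc_eq_discr) (simp_all add: degree_generic_poly)

lemma generic_disc_support:
  assumes n: "n \<ge> 2" and m: "m \<in> Poly_Mapping.keys (generic_disc n)"
  shows "Poly_Mapping.lookup m 0 > 0 \<or> Poly_Mapping.lookup m 1 \<ge> 2"
proof -
  have "generic_disc n \<in>
      supported_on {m. Poly_Mapping.lookup m 0 > 0 \<or> Poly_Mapping.lookup m 1 \<ge> 2}"
    unfolding generic_disc_eq_discr[OF order.trans[OF one_le_numeral n]]
    by (rule discr_in_double_root_ideal[OF n])
       (use n indet_supported_on in \<open>auto simp: coeff_generic_poly\<close>)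
  then show ?thesis using m by (auto simp: supported_on_def)
qed

lemma generic_disc_not_divisible:
  assumes n: "n \<ge> 1"
  shows "\<exists>m\<in>Poly_Mapping.keys (generic_disc n). Poly_Mapping.lookup m 0 = 0"
proof (rule ccontr)
  assume neg: "\<not> ?thesis"
  \<comment> \<open>Its roots 0, ..., n-1 are distinct, so its discriminant is nonzero although its
    constant term is zero.\<close>
  define h :: "real poly" where "h = (\<Prod>i<n. [:- real i, 1:])"
  let ?v = "Polynomial.coeff h"
  have "?v 0 = poly h 0" by (simp add: poly_0_coeff_0)
  also have "\<dots> = 0" using n by (auto simp: h_def poly_prod)
  finally have v0: "?v 0 = 0" .
  have deg: "Polynomial.degree h = n" by (simp add: h_def degree_prod_eq_sum_degree)
  interpret comm_ring_hom "eval_mpoly ?v" by (rule eval_mpoly_hom)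
  have "eval_mpoly ?v (generic_disc n) =
      discr n (\<lambda>i. eval_mpoly ?v (Polynomial.coeff (generic_poly n) i))"
    using n by (simp add: generic_disc_eq_discr hom_discr)
  also have "(\<lambda>i. eval_mpoly ?v (Polynomial.coeff (generic_poly n) i)) = ?v"
    using deg by (auto simp: coeff_generic_poly coeff_eq_0 fun_eq_iff)
  also have "discr n ?v = (\<Prod>(i, j)\<in>{(i, j). i < j \<and> j < n}. (real i - real j)\<^sup>2)"
    using discr_eq_prod_roots[OF n, of 1 h real] by (simp add: h_def)
  also have "\<dots> \<noteq> 0"
  proof -
    have "finite {(i, j). i < j \<and> j < n}" by (rule finite_subset[of _ "{..<n} \<times> {..<n}"]) auto
    then show ?thesis by (auto simp: prod_zero_iff)
  qed
  finally have "eval_mpoly ?v (generic_disc n) \<noteq> 0" .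
  moreover have "eval_mpoly ?v (generic_disc n) = 0"
    using v0 neg by (intro eval_mpoly_eq_0[of _ 0]) auto
  ultimately show False by contradiction
qed

text \<open>A monomial free of a_0 exists, and by the support condition it carries a_1 to a power at
  least 2.\<close>

lemma degree_generic_disc_in_var_1:
  assumes n: "n \<ge> 2"
  shows "Polynomial.degree (poly_in_var 1 (generic_disc n)) \<ge> 2"
proof -
  obtain m where m: "m \<in> Poly_Mapping.keys (generic_disc n)" "Poly_Mapping.lookup m 0 = 0"
    using generic_disc_not_divisible[of n] n by auto
  let ?e = "Poly_Mapping.lookup m 1"
  have e: "?e \<ge> 2" using generic_disc_support[OF n m(1)] m(2) by simp
  have eq: "Poly_Mapping.update 1 0 m + Poly_Mapping.single 1 ?e = m"
    by (rule poly_mapping_eqI) (simp add: lookup_update lookup_add lookup_single when_def)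
  have "Poly_Mapping.lookup (Polynomial.coeff (poly_in_var 1 (generic_disc n)) ?e)
      (Poly_Mapping.update 1 0 m) = Poly_Mapping.lookup (generic_disc n) m"
    unfolding lookup_coeff_poly_in_var eq by (simp add: lookup_update)
  also have "\<dots> \<noteq> 0" using m(1) by (simp add: in_keys_iff)
  finally have "Polynomial.coeff (poly_in_var 1 (generic_disc n)) ?e \<noteq> 0" by auto
  then have "?e \<le> Polynomial.degree (poly_in_var 1 (generic_disc n))" by (rule le_degree)
  then show ?thesis using e by simp
qed

lemma coeff_poly_in_var_polys_in:
  assumes "P \<in> polys_in V"
  shows "Polynomial.coeff (poly_in_var k P) e \<in> polys_in (V - {k})"
  unfolding polys_in_def
proof (intro CollectI ballI subsetI)
  fix m i
  assume m: "m \<in> Poly_Mapping.keys (Polynomial.coeff (poly_in_var k P) e)"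
    and i: "i \<in> Poly_Mapping.keys m"
  have "Poly_Mapping.lookup m k = 0" "m + Poly_Mapping.single k e \<in> Poly_Mapping.keys P"
    using m by (auto simp: in_keys_iff lookup_coeff_poly_in_var split: if_splits)
  then have "i \<noteq> k" "Poly_Mapping.keys (m + Poly_Mapping.single k e) \<subseteq> V"
    using i assms by (auto simp: in_keys_iff polys_in_def)
  then show "i \<in> V - {k}" using i by (auto simp: keys_add_nat)
qed

theorem theorem4p1:
  fixes n :: nat
  assumes "n \<ge> 2"
  shows "double_disc n 1 \<in> polys_in ({0..n} - {1}) \<and>
    (\<exists>q \<in> polys_in ({0..n} - {1}). double_disc n 1 = indet 0 * q)"
proof -
  let ?g = "poly_in_var 1 (generic_disc n)"
  let ?U = "{m :: nat \<Rightarrow>\<^sub>0 nat. Poly_Mapping.lookup m 0 > 0}"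
  let ?d = "Polynomial.degree ?g"
  have d: "?d \<ge> 2" using assms by (rule degree_generic_disc_in_var_1)
  have DD: "double_disc n 1 = discr ?d (Polynomial.coeff ?g)"
    unfolding double_disc_def using d by (intro disc_eq_discr) auto
  have "Polynomial.coeff (generic_poly n) i \<in> polys_in {0..n}" for i
    by (auto simp: coeff_generic_poly polys_in_def indet_def)
  then have "generic_disc n \<in> polys_in {0..n}"
    using assms by (simp add: generic_disc_eq_discr polys_in_discr)
  then have in_V: "double_disc n 1 \<in> polys_in ({0..n} - {1})"
    unfolding DD by (intro polys_in_discr coeff_poly_in_var_polys_in)
  \<comment> \<open>For e < 2 the monomial m * a_1^e cannot satisfy the alternative of being
    divisible by a_1^2, so it contains a_0.\<close>
  have low: "Polynomial.coeff ?g e \<in> supported_on ?U" if "e < 2" for e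
    unfolding supported_on_def
  proof (intro CollectI subsetI)
    fix m assume "m \<in> Poly_Mapping.keys (Polynomial.coeff ?g e)"
    then have "Poly_Mapping.lookup m 1 = 0"
      "m + Poly_Mapping.single 1 e \<in> Poly_Mapping.keys (generic_disc n)"
      by (auto simp: in_keys_iff lookup_coeff_poly_in_var split: if_splits)
    then show "Poly_Mapping.lookup m 0 > 0"
      using generic_disc_support[OF assms, of "m + Poly_Mapping.single 1 e"] that
      by (auto simp: lookup_add lookup_single)
  qed
  have "double_disc n 1 \<in> supported_on ?U"
    unfolding DD by (rule discr_in_indet_ideal[OF d]) (rule low, simp)+
  then have "\<forall>m\<in>Poly_Mapping.keys (double_disc n 1). Poly_Mapping.lookup m 0 > 0"
    by (auto simp: supported_on_def)
  from indet_factor[OF in_V this] in_V show ?thesis by blast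
qed

end
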